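(* Let $c_n := |A_n \setminus A_{n-1}|$ for $n \geq 0$. There is a constant $C \approx 1.339899757746$, namely $C = \exp\left(\sum_{k=2}^{\infty} 2^{-k} \log\frac{c_k}{c_{k-1}^2}\right)$ (the series converges), such that \[ c_n = C^{2^n} + O\left(C^{2^{n-1}}\right) \quad (n \to \infty). \]
   Context: The adjunctive hierarchy of hereditarily finite sets is defined by $A_0 := \{\emptyset\}$ and $A_{n+1} := \{\emptyset\} \cup \{ x \cup \{y\} : x, y \in A_n\}$, with the convention $A_{-1} := \emptyset$. *)

theory Defs
  imports Complex_Main "HOL-Library.FSet" "HOL-Library.Landau_Symbols"
begin

text \<open>
  Hereditarily finite sets: as an inductive datatype nested through finite sets, \<open>hf\<close> is
  extensional and well-founded, and \<open>HF\<close> is a bijection from finite sets of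
  hereditarily finite sets onto hereditarily finite sets.
\<close>
datatype hf = HF (elts: "hf fset")

definition hempty :: hf  where
  "hempty = HF {||}"

text \<open>\<open>adjoin x y\<close> is the set \<open>x \<union> {y}\<close>.\<close>
definition adjoin :: "hf \<Rightarrow> hf \<Rightarrow> hf"  where
  "adjoin x y = HF (elts x |\<union>| {|y|})"

primrec adj_level :: "nat \<Rightarrow> hf set"  where
  "adj_level 0 = {hempty}"
| "adj_level (Suc n) = {hempty} \<union> {adjoin x y | x y. x \<in> adj_level n \<and> y \<in> adj_level n}"

text \<open>
  The case \<open>n = 0\<close> encodes the convention that level \<open>-1\<close> is empty. The cardinality is
  never the junk value for infinite sets, by \<open>finite_adj_level\<close> below.
\<close>
definition adj_count :: "nat \<Rightarrow> nat"  where
  "adj_count n = card (adj_level n - (case n of 0 \<Rightarrow> {} | Suc m \<Rightarrow> adj_level m))"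

lemma finite_adj_level: "finite (adj_level n)"
  by (induction n) (simp_all add: finite_image_set2)

text \<open>
  The series of the theorem starts at \<open>k = 2\<close>; its term with index \<open>k\<close> is
  \<open>adj_term (k - 2)\<close>, so that the series is \<open>\<Sum>j. adj_term j\<close>.
\<close>
definition adj_term :: "nat \<Rightarrow> real"  where
  "adj_term j = (1 / 2 ^ (j + 2)) * ln (real (adj_count (j + 2)) / real (adj_count (j + 1)) ^ 2)"

end

theory Submission
  imports Defs
begin

text \<open>
  Write \<open>a\<^sub>n\<close> for the size of level \<open>n\<close> and \<open>c\<^sub>n\<close> for \<open>adj_count n\<close>. Splitting a set of level
  \<open>n + 1\<close> according to whether it has an element of exact level \<open>n\<close> gives
  \<open>a\<^sub>n\<^sub>+\<^sub>1 \<ge> a\<^sub>n c\<^sub>n + a\<^sub>n\<close>, hence \<open>c\<^sub>n\<^sub>+\<^sub>1 \<ge> c\<^sub>n\<^sup>2\<close>; conversely \<open>a\<^sub>n\<^sub>+\<^sub>1 \<le> a\<^sub>n\<^sup>2 + 1\<close> and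
  \<open>a\<^sub>n \<le> c\<^sub>n + 2 \<surd>c\<^sub>n\<close>. So \<open>2\<^sup>-\<^sup>n ln c\<^sub>n\<close> increases while \<open>2\<^sup>-\<^sup>n (ln c\<^sub>n + 4 / \<surd>c\<^sub>n)\<close> decreases, and
  with \<open>C\<close> the exponential of the common limit, \<open>c\<^sub>n \<le> C ^ (2 ^ n) \<le> c\<^sub>n exp (4 / \<surd>c\<^sub>n)\<close>. This gives
  the asymptotics, and the exact value of \<open>c\<^sub>8\<close> determines \<open>C\<close> to more than 12 decimals.
\<close>

section \<open>Levels and the criterion for membership\<close>

text \<open>Shifting the index by one makes the empty level -1 the value at 0, so later recursions
  can start there.\<close>

definition below_level :: "nat \<Rightarrow> hf set" where
  "below_level n = (case n of 0 \<Rightarrow> {} | Suc m \<Rightarrow> adj_level m)"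

lemma below_level_simps [simp]:
  "below_level 0 = {}" "below_level (Suc n) = adj_level n"
  by (simp_all add: below_level_def)

lemma adj_count_eq: "adj_count n = card (adj_level n - below_level n)"
  by (simp add: adj_count_def below_level_def)

lemma finite_below_level [simp]: "finite (below_level n)"
  by (cases n) (simp_all add: finite_adj_level)

lemma elts_adjoin [simp]: "fset (elts (adjoin x y)) = insert y (fset (elts x))"
  by (simp add: adjoin_def)

lemma elts_hempty [simp]: "fset (elts hempty) = {}"
  by (simp add: hempty_def)

lemma hf_eqI: "fset (elts x) = fset (elts y) \<Longrightarrow> x = y"
  by (simp add: fset_inject hf.expand)

lemma adj_level_mono_Suc: "adj_level n \<subseteq> adj_level (Suc n)"
proof (induction n)
  case (Suc n)
  show ?case
  proof
    fix x assume "x \<in> adj_level (Suc n)"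
    then consider "x = hempty" | y z where "x = adjoin y z" "y \<in> adj_level n" "z \<in> adj_level n"
      by auto
    then show "x \<in> adj_level (Suc (Suc n))"
    proof cases
      case 1
      then show ?thesis by simp
    next
      case 2
      then have "y \<in> adj_level (Suc n)" "z \<in> adj_level (Suc n)" using Suc.IH by blast+
      then show ?thesis using 2(1) by (subst adj_level.simps) blast
    qed
  qed
qed simp

lemma below_level_mono: "i \<le> j \<Longrightarrow> below_level i \<subseteq> below_level j"
proof (rule lift_Suc_mono_le)
  show "below_level n \<subseteq> below_level (Suc n)" for n
    using adj_level_mono_Suc by (cases n) simp_all
qed

text \<open>
  To build \<open>x\<close> as fast as possible, adjoin its elements in order of increasing level; an element
  followed by \<open>j\<close> further ones must be available \<open>j + 1\<close> steps before the end.
\<close>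
lemma mem_adj_level_iff:
  "x \<in> adj_level n \<longleftrightarrow> (\<forall>i\<le>n. card (fset (elts x) - below_level i) + i \<le> n)"
proof (induction n arbitrary: x)
  case 0
  have "card (fset (elts x)) = 0 \<longleftrightarrow> x = hempty"
    using hf_eqI[of x hempty] by auto
  then show ?case by simp
next
  case (Suc n)
  show ?case
  proof
    assume "x \<in> adj_level (Suc n)"
    then consider "x = hempty" | y z where "x = adjoin y z" "y \<in> adj_level n" "z \<in> adj_level n"
      by auto
    then show "\<forall>i\<le>Suc n. card (fset (elts x) - below_level i) + i \<le> Suc n"
    proof cases
      case 1
      then show ?thesis by simp
    next
      case 2
      have y: "card (fset (elts y) - below_level i) + i \<le> n" if "i \<le> n" for i
        using 2 Suc.IH that by blast
      have "card (fset (elts x) - below_level i) + i \<le> Suc n" if "i \<le> n" for i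
      proof -
        have "card (fset (elts x) - below_level i) \<le> card (insert z (fset (elts y) - below_level i))"
          using 2 by (intro card_mono) auto
        also have "\<dots> \<le> Suc (card (fset (elts y) - below_level i))"
          by (simp add: card_insert_if)
        finally show ?thesis using y[OF that] by simp
      qed
      moreover have "fset (elts x) \<subseteq> below_level (Suc n)"
      proof -
        have "fset (elts y) \<subseteq> below_level n" using y[of n] by auto
        then show ?thesis using 2 below_level_mono[of n "Suc n"] by auto
      qed
      ultimately show ?thesis by (auto simp: le_Suc_eq)
    qed
  next
    assume *: "\<forall>i\<le>Suc n. card (fset (elts x) - below_level i) + i \<le> Suc n"
    show "x \<in> adj_level (Suc n)"
    proof (cases "fset (elts x) = {}")
      case True
      then show ?thesis using hf_eqI[of x hempty] by simp
    next
      case False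
      have sub: "fset (elts x) \<subseteq> adj_level n"
        using *[rule_format, of "Suc n"] by auto
      \<comment> \<open>An element of largest level is adjoined last. The \<open>LEAST\<close> is
        attained on the elements of \<open>x\<close>, since by \<open>sub\<close> they all lie in
        \<open>below_level (Suc n)\<close>.\<close>
      define lev where "lev y = (LEAST i. y \<in> below_level i)" for y
      obtain y where y: "y \<in> fset (elts x)" and ymax: "\<forall>z\<in>fset (elts x). lev z \<le> lev y"
      proof -
        have "Max (lev ` fset (elts x)) \<in> lev ` fset (elts x)"
          using False by (intro Max_in) auto
        then obtain y where "y \<in> fset (elts x)" "lev y = Max (lev ` fset (elts x))"
          by auto
        then show thesis using that[of y] by simp
      qed
      \<comment> \<open>\<open>y\<close> lies outside every \<open>below_level i\<close> that misses
        some element of \<open>x\<close>, so removing it lowers each nonzero count by exactly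
        one.\<close>
      have top: "y \<notin> below_level i" if "z \<in> fset (elts x) - below_level i" for z i
      proof
        assume "y \<in> below_level i"
        then have "lev y \<le> i" unfolding lev_def by (rule Least_le)
        then have "lev z \<le> i" using ymax that by force
        moreover have "z \<in> below_level (Suc n)" using sub that by auto
        then have "z \<in> below_level (lev z)" unfolding lev_def by (rule LeastI)
        ultimately have "z \<in> below_level i" using below_level_mono[of "lev z" i] by blast
        then show False using that by simp
      qed
      define x' where "x' = HF (elts x |-| {|y|})"
      have x': "fset (elts x') = fset (elts x) - {y}" by (simp add: x'_def)
      have "card (fset (elts x') - below_level i) + i \<le> n" if "i \<le> n" for i
      proof (cases "fset (elts x) - below_level i = {}")
        case True
        then have "fset (elts x') - below_level i = {}" unfolding x' by blast
        then show ?thesis using that by (metis add_0 card.empty)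
      next
        case False
        then have "y \<in> fset (elts x) - below_level i" using top y by blast
        moreover have "fset (elts x') - below_level i = (fset (elts x) - below_level i) - {y}"
          unfolding x' by blast
        ultimately have "Suc (card (fset (elts x') - below_level i))
            = card (fset (elts x) - below_level i)"
          by (metis card_Suc_Diff1 finite_Diff finite_fset)
        then show ?thesis using *[rule_format, of i] that by simp
      qed
      then have "x' \<in> adj_level n" using Suc.IH by blast
      moreover have "x = adjoin x' y"
        by (rule hf_eqI) (use y x' in auto)
      moreover have "y \<in> adj_level n" using sub y by blast
      ultimately show ?thesis by auto
    qed
  qed
qed

section \<open>Counting admissible element sets\<close>

text \<open>
  Admissible element sets with \<open>r\<close> units of slack; the slack makes the count recursive, as the
  elements of \<open>L (Suc m) - L m\<close> use up part of it.
\<close>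
definition budget_sets :: "(nat \<Rightarrow> 'a set) \<Rightarrow> nat \<Rightarrow> nat \<Rightarrow> 'a set set" where
  "budget_sets L m r = {s. s \<subseteq> L m \<and> (\<forall>i\<le>m. card (s - L i) + i \<le> m + r)}"

lemma finite_budget_sets: "finite (L m) \<Longrightarrow> finite (budget_sets L m r)"
  by (rule finite_subset[of _ "Pow (L m)"]) (auto simp: budget_sets_def)

lemma card_budget_sets_mono:
  assumes "finite (L m)" "r \<le> r'"
  shows "card (budget_sets L m r) \<le> card (budget_sets L m r')"
  using assms by (intro card_mono finite_budget_sets) (force simp: budget_sets_def)+

lemma card_budget_sets_0: "L 0 = {} \<Longrightarrow> card (budget_sets L 0 r) = 1"
proof -
  assume "L 0 = {}"
  then have "budget_sets L 0 r = {{}}" by (auto simp: budget_sets_def)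
  then show ?thesis by simp
qed

text \<open>Split a set into its part \<open>u\<close> in the top layer and its part
  \<open>v\<close> in \<open>L m\<close>. Each element of \<open>u\<close> counts at every index
  \<open>i \<le> m\<close>, so \<open>v\<close> is left with the total
  \<open>m + (Suc r - card u)\<close>. The binomial counts the \<open>u\<close> of size
  \<open>k\<close>.\<close>

lemma card_budget_sets_Suc:
  assumes mono: "mono L" and fin: "finite (L (Suc m))"
  shows "card (budget_sets L (Suc m) r) =
    (\<Sum>k\<le>Suc r. (card (L (Suc m) - L m) choose k) * card (budget_sets L m (Suc r - k)))"
proof -
  define D where "D = L (Suc m) - L m"
  have sub: "L m \<subseteq> L (Suc m)" using mono by (simp add: monoD)
  have finD: "finite D" and finL: "finite (L m)"
    using fin sub finite_subset by (auto simp: D_def)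
  \<comment> \<open>The constraint at \<open>i = m\<close> forces \<open>card u \<le> Suc r\<close>,
    so the subtraction \<open>Suc r - card u\<close> never truncates.\<close>
  define U where "U = {u. u \<subseteq> D \<and> card u \<le> Suc r}"
  have finU: "finite U"
    by (rule finite_subset[of _ "Pow D"]) (auto simp: U_def finD)
  have split: "card (u \<union> v - L i) = card u + card (v - L i)"
    if "u \<subseteq> D" "v \<subseteq> L m" "i \<le> m" for u v i
  proof -
    have "L i \<subseteq> L m" using mono that by (simp add: monoD)
    then have "u \<union> v - L i = u \<union> (v - L i)" "u \<inter> (v - L i) = {}"
      using that by (auto simp: D_def)
    then show ?thesis
      using that finD finL by (metis card_Un_disjoint finite_Diff finite_subset)
  qed
  have "bij_betw (\<lambda>(u, v). u \<union> v) (Sigma U (\<lambda>u. budget_sets L m (Suc r - card u)))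
          (budget_sets L (Suc m) r)"
  proof (rule bij_betw_byWitness[where f' = "\<lambda>s. (s \<inter> D, s \<inter> L m)"])
    show "\<forall>p\<in>Sigma U (\<lambda>u. budget_sets L m (Suc r - card u)).
        (\<lambda>s. (s \<inter> D, s \<inter> L m)) (case p of (u, v) \<Rightarrow> u \<union> v) = p"
      by (auto simp: U_def budget_sets_def D_def)
    show "\<forall>s\<in>budget_sets L (Suc m) r. (case (s \<inter> D, s \<inter> L m) of (u, v) \<Rightarrow> u \<union> v) = s"
      by (auto simp: budget_sets_def D_def)
    show "(\<lambda>(u, v). u \<union> v) ` Sigma U (\<lambda>u. budget_sets L m (Suc r - card u))
        \<subseteq> budget_sets L (Suc m) r"
    proof clarify
      fix u v assume u: "u \<in> U" and v: "v \<in> budget_sets L m (Suc r - card u)"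
      have uv: "u \<subseteq> D" "card u \<le> Suc r" "v \<subseteq> L m" using u v by (auto simp: U_def budget_sets_def)
      have un: "u \<union> v \<subseteq> L (Suc m)" using uv sub by (auto simp: D_def)
      have "card (u \<union> v - L i) + i \<le> Suc m + r" if "i \<le> Suc m" for i
      proof (cases "i = Suc m")
        case True
        have "u \<union> v - L (Suc m) = {}" using un by blast
        then show ?thesis using True by (metis add_0 card.empty le_add1)
      next
        case False
        then have "i \<le> m" using that by simp
        moreover from this have "card (v - L i) + i \<le> m + (Suc r - card u)"
          using v by (simp add: budget_sets_def)
        ultimately show ?thesis using split[OF uv(1,3)] uv(2) by simp
      qed
      then show "u \<union> v \<in> budget_sets L (Suc m) r"
        using un by (simp add: budget_sets_def)
    qed
    show "(\<lambda>s. (s \<inter> D, s \<inter> L m)) ` budget_sets L (Suc m) r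
        \<subseteq> Sigma U (\<lambda>u. budget_sets L m (Suc r - card u))"
    proof clarify
      fix s assume s: "s \<in> budget_sets L (Suc m) r"
      have un: "s \<inter> D \<union> s \<inter> L m = s" using s by (auto simp: budget_sets_def D_def)
      have *: "card (s \<inter> D) + card (s \<inter> L m - L i) + i \<le> Suc m + r" if "i \<le> m" for i
      proof -
        have "card (s - L i) + i \<le> Suc m + r" using s that by (simp add: budget_sets_def)
        then show ?thesis using split[of "s \<inter> D" "s \<inter> L m" i] un that by simp
      qed
      have le: "card (s \<inter> D) \<le> Suc r" using *[of m] by simp
      have "card (s \<inter> L m - L i) + i \<le> m + (Suc r - card (s \<inter> D))" if "i \<le> m" for i
        using *[OF that] le by simp
      then show "s \<inter> D \<in> U \<and> s \<inter> L m \<in> budget_sets L m (Suc r - card (s \<inter> D))"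
        using le by (simp add: U_def budget_sets_def)
    qed
  qed
  then have "card (budget_sets L (Suc m) r)
      = card (Sigma U (\<lambda>u. budget_sets L m (Suc r - card u)))"
    by (simp add: bij_betw_same_card)
  also have "\<dots> = (\<Sum>u\<in>U. card (budget_sets L m (Suc r - card u)))"
    using finU by (simp add: finite_budget_sets finL)
  also have "\<dots> = (\<Sum>k\<le>Suc r. \<Sum>u\<in>{u\<in>U. card u = k}. card (budget_sets L m (Suc r - card u)))"
    by (rule sum.group[symmetric]) (use finU in \<open>auto simp: U_def\<close>)
  also have "\<dots> = (\<Sum>k\<le>Suc r. (card D choose k) * card (budget_sets L m (Suc r - k)))"
  proof (rule sum.cong)
    fix k assume "k \<in> {..Suc r}"
    then have "{u \<in> U. card u = k} = {u. u \<subseteq> D \<and> card u = k}" by (auto simp: U_def)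
    then show "(\<Sum>u\<in>{u\<in>U. card u = k}. card (budget_sets L m (Suc r - card u)))
        = (card D choose k) * card (budget_sets L m (Suc r - k))"
      using n_subsets[OF finD, of k] by simp
  qed simp
  finally show ?thesis by (simp add: D_def)
qed

section \<open>Recursion for the counts and exact values\<close>

definition budget_count :: "nat \<Rightarrow> nat \<Rightarrow> nat" where
  "budget_count m r = card (budget_sets below_level m r)"

lemma budget_count_0: "budget_count 0 r = 1"
  by (simp add: budget_count_def card_budget_sets_0)

lemma budget_count_Suc:
  "budget_count (Suc m) r = (\<Sum>k\<le>Suc r. (adj_count m choose k) * budget_count m (Suc r - k))"
  using card_budget_sets_Suc[of below_level m r]
  by (simp add: budget_count_def adj_count_eq monoI below_level_mono finite_adj_level)

text \<open>Without slack, admissibility is the criterion of \<open>mem_adj_level_iff\<close>, whose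
  instance \<open>i = n\<close> supplies the inclusion in \<open>below_level n\<close>. Passing to
  element sets is injective by extensionality and onto because admissible sets are finite.\<close>

lemma card_adj_level: "card (adj_level n) = budget_count n 0"
proof -
  have "(\<lambda>x. fset (elts x)) ` adj_level n = budget_sets below_level n 0"
  proof (intro equalityI subsetI)
    fix s assume "s \<in> (\<lambda>x. fset (elts x)) ` adj_level n"
    then obtain x where x: "x \<in> adj_level n" "s = fset (elts x)" by auto
    then have *: "card (s - below_level i) + i \<le> n" if "i \<le> n" for i
      using mem_adj_level_iff[of x n] that by simp
    have "s \<subseteq> below_level n" using *[of n] x by auto
    then show "s \<in> budget_sets below_level n 0" using * by (simp add: budget_sets_def)
  next
    fix s assume s: "s \<in> budget_sets below_level n 0"
    then have "finite s" by (auto simp: budget_sets_def intro: finite_subset)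
    then have "fset (elts (HF (Abs_fset s))) = s" by (simp add: Abs_fset_inverse)
    moreover from this have "HF (Abs_fset s) \<in> adj_level n"
      using s by (simp add: mem_adj_level_iff budget_sets_def del: hf.sel)
    ultimately show "s \<in> (\<lambda>x. fset (elts x)) ` adj_level n" by (metis imageI)
  qed
  moreover have "inj_on (\<lambda>x. fset (elts x)) (adj_level n)"
    by (auto intro: inj_onI hf_eqI)
  ultimately show ?thesis
    by (metis budget_count_def card_image)
qed

lemma card_adj_level_Suc:
  "card (adj_level (Suc n)) = card (adj_level n) + adj_count (Suc n)"
  using adj_level_mono_Suc[of n] finite_adj_level
  by (simp add: adj_count_eq card_Diff_subset card_mono del: adj_level.simps)

lemma adj_count_0: "adj_count 0 = 1"
  by (simp add: adj_count_eq)

lemma adj_count_Suc: "adj_count (Suc m) = budget_count (Suc m) 0 - budget_count m 0"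
  using card_adj_level_Suc[of m] by (simp add: card_adj_level del: adj_level.simps)

text \<open>Makes binomials with huge upper and small lower argument cheap to evaluate.\<close>

lemma binomial_Suc_right: "n choose Suc k = (n choose k) * (n - k) div Suc k"
proof -
  have "Suc k * (n choose Suc k) = (n choose k) * (n - k)"
    by (metis binomial_absorption binomial_absorb_comp mult.commute)
  then show ?thesis by (metis nonzero_mult_div_cancel_left nat.distinct(1))
qed

text \<open>Row \<open>m + 1\<close> at slack \<open>r\<close> needs row \<open>m\<close> up to
  slack \<open>r + 1\<close>, so \<open>adj_count 8\<close> is read off the triangle of values
  \<open>budget_count m r\<close> with \<open>m + r \<le> 8\<close>.\<close>

lemma adj_count_values:
  "adj_count (Suc 0) = 1" "adj_count 2 = 2" "adj_count 8 = 339243082977367792104410545944616"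
proof -
  have choose: "n choose numeral k = (n choose pred_numeral k) * (n - pred_numeral k) div numeral k"
    for n k
    using binomial_Suc_right[of n "pred_numeral k"] by (simp add: numeral_eq_Suc)
  have rec: "budget_count (numeral n) r = (\<Sum>k\<le>Suc r.
      (adj_count (pred_numeral n) choose k) * budget_count (pred_numeral n) (Suc r - k))" for n r
    using budget_count_Suc[of "pred_numeral n" r] by (simp add: numeral_eq_Suc)
  have count: "adj_count (numeral n) = budget_count (numeral n) 0 - budget_count (pred_numeral n) 0"
    for n
    using adj_count_Suc[of "pred_numeral n"] by (simp add: numeral_eq_Suc)
  have two: "Suc (Suc 0) = 2" by simp
  note eval = atMost_nat_numeral atMost_Suc choose two
  \<comment> \<open>The only candidate element is \<open>hempty\<close>, so at any slack both
    subsets of a singleton are admissible.\<close>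
  have f1: "budget_count (Suc 0) r = 2" for r
  proof -
    have "(\<Sum>k\<le>Suc r. ((1::nat) choose k)) = 2"
      by (induction r) (simp_all add: numeral_2_eq_2)
    then show ?thesis using budget_count_Suc[of 0 r]
      by (simp add: adj_count_0 budget_count_0 del: sum.atMost_Suc)
  qed
  have c1: "adj_count (Suc 0) = 1"
    using adj_count_Suc[of 0] by (simp add: f1 budget_count_0)
  have f2: "budget_count 2 0 = 4" "budget_count 2 (Suc 0) = 4" "budget_count 2 2 = 4"
    "budget_count 2 3 = 4" "budget_count 2 4 = 4" "budget_count 2 5 = 4" "budget_count 2 6 = 4"
    by (simp_all add: rec[of "num.Bit0 num.One"] f1 c1 eval
        del: sum.atMost_Suc)
  have c2: "adj_count 2 = 2"
    by (simp add: count f2 f1)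
  have f3: "budget_count 3 0 = 12" "budget_count 3 (Suc 0) = 16" "budget_count 3 2 = 16"
    "budget_count 3 3 = 16" "budget_count 3 4 = 16" "budget_count 3 5 = 16"
    by (simp_all add: rec[of "num.Bit1 num.One"] f2 c2 eval
        del: sum.atMost_Suc)
  have c3: "adj_count 3 = 8"
    by (simp add: count f3 f2)
  have f4: "budget_count 4 0 = 112" "budget_count 4 (Suc 0) = 480" "budget_count 4 2 = 1264"
    "budget_count 4 3 = 2328" "budget_count 4 4 = 3280"
    by (simp_all add: rec[of "num.Bit0 (num.Bit0 num.One)"] f3 c3 eval
        del: sum.atMost_Suc)
  have c4: "adj_count 4 = 100"
    by (simp add: count f4 f3)
  have f5: "budget_count 5 0 = 11680" "budget_count 5 (Suc 0) = 603664"
    "budget_count 5 2 = 20615128" "budget_count 5 3 = 523286080"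
    by (simp_all add: rec[of "num.Bit1 (num.Bit0 num.One)"] f4 c4 eval
        del: sum.atMost_Suc)
  have c5: "adj_count 5 = 11568"
    by (simp add: count f5 f4)
  have f6: "budget_count 6 0 = 135717904" "budget_count 6 (Suc 0) = 788437007320"
    "budget_count 6 2 = 3053311741288256"
    by (simp_all add: rec[of "num.Bit0 (num.Bit1 num.One)"] f5 c5 eval
        del: sum.atMost_Suc)
  have c6: "adj_count 6 = 135706224"
    by (simp add: count f6 f5)
  have f7: "budget_count 7 0 = 18418552718041816"
    "budget_count 7 (Suc 0) = 1249809612204187991282240"
    by (simp_all add: rec[of "num.Bit1 (num.Bit1 num.One)"] f6 c6 eval
        del: sum.atMost_Suc)
  have c7: "adj_count 7 = 18418552582323912"
    by (simp add: count f7 f6)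
  have f8: "budget_count 8 0 = 339243082977367810522963263986432"
    by (simp_all add: rec[of "num.Bit0 (num.Bit0 (num.Bit0 num.One))"] f7 c7 eval
        del: sum.atMost_Suc)
  show "adj_count (Suc 0) = 1" "adj_count 2 = 2" by (fact c1 c2)+
  show "adj_count 8 = 339243082977367792104410545944616" by (simp add: count f8 f7)
qed

section \<open>Growth bounds for successive counts\<close>

lemma adj_count_le_card: "adj_count n \<le> card (adj_level n)"
  by (simp add: adj_count_eq card_mono finite_adj_level)

lemma adj_count_Suc_ge: "(adj_count n)\<^sup>2 \<le> adj_count (Suc n)"
proof -
  \<comment> \<open>At slack 0 only \<open>k = 0\<close> and \<open>k = 1\<close> occur. The first
    term is at least the size of level \<open>n\<close>, which pays for the subtraction in
    \<open>adj_count_Suc\<close>.\<close>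
  have "budget_count (Suc n) 0 = budget_count n 1 + adj_count n * budget_count n 0"
    by (simp add: budget_count_Suc)
  moreover have "budget_count n 0 \<le> budget_count n 1"
    unfolding budget_count_def by (rule card_budget_sets_mono) simp_all
  moreover have "(adj_count n)\<^sup>2 \<le> adj_count n * budget_count n 0"
    using adj_count_le_card[of n] by (simp add: power2_eq_square card_adj_level)
  ultimately show ?thesis by (simp add: adj_count_Suc)
qed

lemma adj_count_pos: "adj_count n \<ge> 1"
proof (induction n)
  case (Suc n)
  then have "1 \<le> (adj_count n)\<^sup>2" by simp
  then show ?case using adj_count_Suc_ge order_trans by blast
qed (simp add: adj_count_0)

lemma adj_count_ge_2: "n \<ge> 2 \<Longrightarrow> adj_count n \<ge> 2"
proof (induction n rule: nat_induct_at_least)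
  case (Suc n)
  then have "2 \<le> (adj_count n)\<^sup>2" using mult_le_mono[of 1 "adj_count n" 2 "adj_count n"]
    by (simp add: power2_eq_square)
  then show ?case using adj_count_Suc_ge order_trans by blast
qed (simp add: adj_count_values)

text \<open>Induction from 2: the earlier levels contribute at most 2 c_n \<le> c_n^2 \<le> c_(n+1),
  where c_n \<ge> 2 is essential. Levels 0 and 1, with c_n = 1, are checked separately.\<close>

lemma card_adj_level_le: "card (adj_level n) \<le> 2 * adj_count n"
proof -
  have "card (adj_level n) \<le> 2 * adj_count n" if "n \<ge> 2" for n
    using that
  proof (induction n rule: nat_induct_at_least)
    case base
    have "card (adj_level 2) = card (adj_level 0) + adj_count (Suc 0) + adj_count 2"
      using card_adj_level_Suc[of 0] card_adj_level_Suc[of 1]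
      by (simp add: numeral_2_eq_2 del: adj_level.simps)
    then show ?case by (simp add: adj_count_values)
  next
    case (Suc n)
    have "2 * adj_count n \<le> (adj_count n)\<^sup>2"
      using adj_count_ge_2[OF Suc.hyps] by (simp add: power2_eq_square)
    also have "\<dots> \<le> adj_count (Suc n)" by (rule adj_count_Suc_ge)
    finally show ?case using Suc.IH card_adj_level_Suc[of n] by simp
  qed
  moreover have "card (adj_level (Suc 0)) \<le> 2 * adj_count (Suc 0)"
    using card_adj_level_Suc[of 0] by (simp add: adj_count_values del: adj_level.simps(2))
  moreover have "card (adj_level 0) \<le> 2 * adj_count 0"
    by (simp add: adj_count_0)
  ultimately show ?thesis by (cases "n \<ge> 2") (auto simp: less_2_cases_iff not_le)
qed

text \<open>Pairs give at most a_n^2 adjunctions; the 1 added for the empty set is absorbed on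
  subtracting a_n \<ge> 1.\<close>

lemma adj_count_Suc_le: "adj_count (Suc n) \<le> (card (adj_level n))\<^sup>2"
proof -
  let ?A = "adj_level n"
  have "adj_level (Suc n) = insert hempty ((\<lambda>(x, y). adjoin x y) ` (?A \<times> ?A))"
    by auto
  then have "card (adj_level (Suc n)) \<le> Suc (card ((\<lambda>(x, y). adjoin x y) ` (?A \<times> ?A)))"
    by (simp add: card_insert_if finite_adj_level)
  also have "\<dots> \<le> Suc (card (?A \<times> ?A))"
    using card_image_le[of "?A \<times> ?A"] by (simp add: finite_adj_level del: card_cartesian_product)
  finally have "card (adj_level (Suc n)) \<le> Suc ((card ?A)\<^sup>2)"
    by (simp add: card_cartesian_product power2_eq_square)
  moreover have "card ?A \<ge> 1"
    using adj_count_pos[of n] adj_count_le_card[of n] by simp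
  ultimately show ?thesis using card_adj_level_Suc[of n] by simp
qed

lemma adj_count_mono: "adj_count n \<le> adj_count (Suc n)"
proof -
  have "adj_count n * 1 \<le> (adj_count n)\<^sup>2"
    unfolding power2_eq_square by (rule mult_le_mono2) (rule adj_count_pos)
  then show ?thesis using adj_count_Suc_ge[of n] by simp
qed

text \<open>Here a_n = c_n + a_(n-1), with a_(n-1) \<le> 2 c_(n-1) and c_(n-1) \<le> sqrt
  c_n.\<close>

lemma adj_count_Suc_le_sqrt:
  assumes "n \<ge> 1"
  shows "real (adj_count (Suc n)) \<le> (real (adj_count n) + 2 * sqrt (real (adj_count n)))\<^sup>2"
proof -
  obtain m where n: "n = Suc m" using assms by (cases n) auto
  have "real (adj_count m) \<le> sqrt (real (adj_count n))"
    using adj_count_Suc_ge[of m] unfolding n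
    by (intro real_le_rsqrt) (metis of_nat_le_iff of_nat_power)
  moreover have "card (adj_level n) \<le> 2 * adj_count m + adj_count n"
    using card_adj_level_Suc[of m] card_adj_level_le[of m] unfolding n by simp
  then have "real (card (adj_level n)) \<le> 2 * real (adj_count m) + real (adj_count n)"
    by linarith
  ultimately have "real (card (adj_level n)) \<le> real (adj_count n) + 2 * sqrt (real (adj_count n))"
    by linarith
  then have "(real (card (adj_level n)))\<^sup>2 \<le> (real (adj_count n) + 2 * sqrt (real (adj_count n)))\<^sup>2"
    by (intro power_mono) auto
  moreover have "real (adj_count (Suc n)) \<le> (real (card (adj_level n)))\<^sup>2"
    using adj_count_Suc_le[of n] by (metis of_nat_le_iff of_nat_power)
  ultimately show ?thesis by linarith
qed

section \<open>Normalised logarithms and their limit\<close>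

definition log_count :: "nat \<Rightarrow> real" where
  "log_count n = ln (real (adj_count n)) / 2 ^ n"

text \<open>The square doubles a logarithm, which matches the two normalisations; hence the series
  telescopes.\<close>

lemma adj_term_eq: "adj_term j = log_count (Suc (Suc j)) - log_count (Suc j)"
proof -
  have "real (adj_count k) > 0" for k
    using adj_count_pos[of k] by simp
  then show ?thesis
    by (simp add: adj_term_def log_count_def ln_div ln_realpow field_simps)
qed

lemma log_count_mono_Suc: "log_count n \<le> log_count (Suc n)"
proof -
  have pos: "real (adj_count k) > 0" for k
    using adj_count_pos[of k] by simp
  have "2 * ln (real (adj_count n)) = ln ((real (adj_count n))\<^sup>2)"
    by (simp add: ln_realpow pos)
  also have "\<dots> \<le> ln (real (adj_count (Suc n)))"
    using adj_count_Suc_ge[of n] pos[of n] pos[of "Suc n"]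
    by (metis ln_le_cancel_iff of_nat_le_iff of_nat_power zero_less_power)
  finally show ?thesis by (simp add: log_count_def field_simps)
qed

definition log_count_upper :: "nat \<Rightarrow> real" where
  "log_count_upper n = log_count n + 4 / (2 ^ n * sqrt (real (adj_count n)))"

text \<open>The constant 4 reproduces itself: one step adds at most 4 / sqrt c_n to the doubled
  logarithm and the new correction is at most 4 / sqrt c_n; the sum 8 / sqrt c_n is halved by the
  new normalisation.\<close>

lemma log_count_upper_antimono_Suc:
  assumes "n \<ge> 1"
  shows "log_count_upper (Suc n) \<le> log_count_upper n"
proof -
  define c where "c = real (adj_count n)"
  define d where "d = real (adj_count (Suc n))"
  have c: "c \<ge> 1" and d: "d \<ge> 1" and cd: "c \<le> d"
    using adj_count_pos[of n] adj_count_pos[of "Suc n"] adj_count_mono[of n] by (auto simp: c_def d_def)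
  have "c + 2 * sqrt c = c * (1 + 2 / sqrt c)"
    using c by (simp add: field_simps real_sqrt_mult_self)
  then have "d \<le> (c * (1 + 2 / sqrt c))\<^sup>2"
    using adj_count_Suc_le_sqrt[OF assms] by (simp add: c_def d_def)
  then have "ln d \<le> ln ((c * (1 + 2 / sqrt c))\<^sup>2)"
    using d by (subst ln_le_cancel_iff) auto
  also have "\<dots> = 2 * (ln c + ln (1 + 2 / sqrt c))"
    using c by (simp add: ln_realpow ln_mult_pos add_pos_nonneg)
  also have "\<dots> \<le> 2 * (ln c + 2 / sqrt c)"
    using c ln_add_one_self_le_self[of "2 / sqrt c"] by simp
  finally have "ln d \<le> 2 * ln c + 4 / sqrt c" by simp
  moreover have "4 / sqrt d \<le> 4 / sqrt c"
    using c cd by (intro divide_left_mono) auto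
  ultimately have "(ln d + 4 / sqrt d) / 2 ^ Suc n \<le> (2 * ln c + 8 / sqrt c) / 2 ^ Suc n"
    by (intro divide_right_mono) auto
  then show ?thesis
    by (simp add: log_count_upper_def log_count_def c_def d_def add_divide_distrib mult.commute)
qed

text \<open>Every term of the increasing sequence is below every term of the decreasing one, so its
  limit \<open>l\<close> lies between the two.\<close>

lemma log_count_limit:
  obtains l where "adj_term sums l"
    "\<And>n. n \<ge> 1 \<Longrightarrow> log_count n \<le> l" "\<And>n. n \<ge> 1 \<Longrightarrow> l \<le> log_count_upper n"
proof -
  define X where "X n = log_count (Suc n)" for n
  define Y where "Y n = log_count_upper (Suc n)" for n
  have incX: "incseq X" by (auto intro: incseq_SucI simp: X_def log_count_mono_Suc)
  have decY: "decseq Y" by (auto intro: decseq_SucI simp: Y_def log_count_upper_antimono_Suc)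
  have XY: "X m \<le> Y n" for m n
  proof -
    have "X m \<le> X (max m n)" using incX by (simp add: incseqD)
    also have "\<dots> \<le> Y (max m n)" by (simp add: X_def Y_def log_count_upper_def)
    also have "\<dots> \<le> Y n" using decY by (simp add: decseqD)
    finally show ?thesis .
  qed
  obtain l where l: "X \<longlonglongrightarrow> l" "\<And>m. X m \<le> l"
    using incseq_convergent[OF incX, of "Y 0"] XY by blast
  have "l \<le> Y n" for n using LIMSEQ_le_const2[OF l(1)] XY by blast
  moreover have "(\<lambda>n. X (Suc n) - X n) sums (l - X 0)"
    using l(1) by (rule telescope_sums)
  \<comment> \<open>The telescoped sum starts from \<open>X 0\<close>, which is
    \<open>log_count 1\<close> and vanishes because \<open>adj_count 1\<close> is 1.\<close>
  then have "adj_term sums l"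
    by (simp add: X_def adj_term_eq[abs_def] log_count_def adj_count_values)
  ultimately show thesis
    using l(2) that[of l] by (metis X_def Y_def Suc_le_D One_nat_def)
qed

section \<open>Numerical bounds on 256th powers\<close>

text \<open>Eight squarings, rounded up, from the lower end of the claimed interval for
  \<open>C\<close>; 256 is 2^8 and the right-hand side is \<open>adj_count 8\<close>.\<close>

lemma power_256_less:
  fixes x :: real
  assumes "0 \<le> x" "x \<le> 1.3398997577455"
  shows "x ^ 256 < 339243082977367792104410545944616"
proof -
  have p1: "x ^ 2 \<le> 1.79533136080644958724278"
    using power_mono[OF assms(2), of 2] assms(1) by (simp add: power_divide)
  have p2: "x ^ 4 \<le> 3.2232146950951380691224"
    using power_mono[OF p1, of 2] assms(1) by (simp add: power_divide)
  have p3: "x ^ 8 \<le> 10.3891129706772438699076"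
    using power_mono[OF p2, of 2] assms(1) by (simp add: power_divide)
  have p4: "x ^ 16 \<le> 107.933668317494147045879"
    using power_mono[OF p3, of 2] assms(1) by (simp add: power_divide)
  have p5: "x ^ 32 \<le> 11649.6767564708398191888"
    using power_mono[OF p4, of 2] assms(1) by (simp add: power_divide)
  have p6: "x ^ 64 \<le> 135714968.530256946931028"
    using power_mono[OF p5, of 2] assms(1) by (simp add: power_divide)
  have p7: "x ^ 128 \<le> 18418552683168633.4502168"
    using power_mono[OF p6, of 2] assms(1) by (simp add: power_divide)
  have p8: "x ^ 256 \<le> 339243082942658466662896814383881"
    using power_mono[OF p7, of 2] assms(1) by (simp add: power_divide)
  show ?thesis using p8 by simp
qed

text \<open>The same from the upper end, rounded down; the extra factor leaves room for
  \<open>exp (4 / sqrt c)\<close> with c = \<open>adj_count 8\<close>.\<close>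

lemma power_256_greater:
  fixes x :: real
  assumes "1.3398997577465 \<le> x"
  shows "339243082977367792104410545944616 * (1 + 2 / 10 ^ 12) < x ^ 256"
proof -
  have p1: "1.79533136080912938675826 \<le> x ^ 2"
    using power_mono[OF assms, of 2] by (simp add: power_divide)
  have p2: "3.22321469510476032534403 \<le> x ^ 4"
    using power_mono[OF p1, of 2] by (simp add: power_divide)
  have p3: "10.3891129707392730652146 \<le> x ^ 8"
    using power_mono[OF p2, of 2] by (simp add: power_divide)
  have p4: "107.933668318783003680931 \<le> x ^ 16"
    using power_mono[OF p3, of 2] by (simp add: power_divide)
  have p5: "11649.6767567490618683033 \<le> x ^ 32"
    using power_mono[OF p4, of 2] by (simp add: power_divide)
  have p6: "135714968.536739340808518 \<le> x ^ 64"
    using power_mono[OF p5, of 2] by (simp add: power_divide)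
  have p7: "18418552684928149.2124273 \<le> x ^ 128"
    using power_mono[OF p6, of 2] by (simp add: power_divide)
  have p8: "339243083007473934192272126100275 \<le> x ^ 256"
    using power_mono[OF p7, of 2] by (simp add: power_divide)
  show ?thesis using p8 by simp
qed

section \<open>Value of the constant and error term\<close>

theorem theorem2:
  shows "summable adj_term \<and>
    (\<exists>C::real. C = exp (\<Sum>j. adj_term j) \<and>
       \<bar>C - 1.339899757746\<bar> < 5 / 10 ^ 13 \<and>
       (\<lambda>n. real (adj_count n) - C ^ (2 ^ n)) \<in> O(\<lambda>n. C ^ (2 ^ (n - 1))))"
proof -
  obtain l where l: "adj_term sums l"
    and lower: "\<And>n. n \<ge> 1 \<Longrightarrow> log_count n \<le> l"
    and upper: "\<And>n. n \<ge> 1 \<Longrightarrow> l \<le> log_count_upper n"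
    by (rule log_count_limit) blast
  define C where "C = exp l"
  have C: "C > 0" by (simp add: C_def)
  have c1: "real (adj_count n) \<ge> 1" for n
    using adj_count_pos[of n] by simp
  have pow: "C ^ (2 ^ n) = exp (2 ^ n * l)" for n
    by (simp add: C_def flip: exp_of_nat_mult)
  have le: "real (adj_count n) \<le> C ^ (2 ^ n)" if "n \<ge> 1" for n
  proof -
    have "ln (real (adj_count n)) \<le> 2 ^ n * l"
      using lower[OF that] by (simp add: log_count_def field_simps)
    then have "exp (ln (real (adj_count n))) \<le> exp (2 ^ n * l)" by simp
    then show ?thesis using c1[of n] by (simp add: pow)
  qed
  have ge: "C ^ (2 ^ n) \<le> real (adj_count n) * exp (4 / sqrt (real (adj_count n)))"
    if "n \<ge> 1" for n
  proof -
    have "2 ^ n * l \<le> 2 ^ n * log_count_upper n"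
      using upper[OF that] by simp
    also have "\<dots> = ln (real (adj_count n)) + 4 / sqrt (real (adj_count n))"
      by (simp add: log_count_upper_def log_count_def distrib_left)
    finally have "exp (2 ^ n * l) \<le> exp (\<dots>)" by simp
    then show ?thesis using c1[of n] by (simp add: pow exp_add)
  qed
  have "\<bar>C - 1.339899757746\<bar> < 5 / 10 ^ 13"
  proof -
    let ?c = "339243082977367792104410545944616 :: real"
    have "C > 1.3398997577455"
      using le[of 8] power_256_less[of C] C by (force simp: adj_count_values)
    moreover have "exp (4 / sqrt ?c) \<le> 1 + 2 / 10 ^ 12"
    proof -
      have "sqrt ?c \<ge> 10 ^ 16"
        by (rule real_le_rsqrt) simp
      then have "4 / sqrt ?c \<le> 4 / 10 ^ 16"
        by (intro divide_left_mono) auto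
      then have "exp (4 / sqrt ?c) \<le> exp (1 / 10 ^ 12)" by simp
      also have "\<dots> \<le> 1 + 1 / 10 ^ 12 + (1 / 10 ^ 12)\<^sup>2"
        by (rule exp_bound) auto
      also have "\<dots> \<le> 1 + 2 / 10 ^ 12" by (simp add: power2_eq_square)
      finally show ?thesis .
    qed
    then have "?c * exp (4 / sqrt ?c) \<le> ?c * (1 + 2 / 10 ^ 12)"
      by (rule mult_left_mono) simp
    then have "C < 1.3398997577465"
      using ge[of 8] power_256_greater[of C] by (force simp: adj_count_values)
    ultimately show ?thesis unfolding abs_less_iff by (simp add: field_simps)
  qed
  moreover have "(\<lambda>n. real (adj_count n) - C ^ (2 ^ n)) \<in> O(\<lambda>n. C ^ (2 ^ (n - 1)))"
  proof (rule bigoI)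
    have "\<bar>real (adj_count n) - C ^ (2 ^ n)\<bar> \<le> 4 * exp 4 * C ^ (2 ^ (n - 1))" if "n \<ge> 1" for n
    proof -
      define c where "c = real (adj_count n)"
      define t where "t = 4 / sqrt c"
      have c: "c \<ge> 1" using c1 by (simp add: c_def)
      have t: "0 \<le> t" "t \<le> 4"
        using c by (auto simp: t_def field_simps)
      \<comment> \<open>This bounds \<open>exp t - 1\<close> by \<open>t * exp 4\<close>, as
        \<open>t \<le> 4\<close>; multiplying by \<open>c\<close> turns \<open>t\<close> into
        \<open>4 * sqrt c\<close>, the order of the error term.\<close>
      have "1 - t \<le> exp (- t)" using exp_ge_add_one_self[of "- t"] by simp
      then have "exp t * (1 - t) \<le> exp t * exp (- t)" by (intro mult_left_mono) auto
      then have "exp t - 1 \<le> t * exp t" by (simp add: exp_minus algebra_simps)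
      also have "\<dots> \<le> t * exp 4" using t by (intro mult_left_mono) auto
      finally have "c * (exp t - 1) \<le> c * (t * exp 4)"
        using c by (intro mult_left_mono) auto
      also have "c * (t * exp 4) = 4 * exp 4 * sqrt c"
        using c real_div_sqrt[of c] by (simp add: t_def field_simps)
      also have "sqrt c \<le> C ^ (2 ^ (n - 1))"
      proof (rule real_le_lsqrt)
        have "(C ^ 2 ^ (n - 1))\<^sup>2 = C ^ 2 ^ n"
          using that by (simp add: power_mult[symmetric] power_Suc2[symmetric] del: power_Suc)
        then show "c \<le> (C ^ 2 ^ (n - 1))\<^sup>2"
          using le[OF that] by (simp add: c_def)
      qed (use c C in auto)
      finally have "c * exp t - c \<le> 4 * exp 4 * C ^ (2 ^ (n - 1))"
        by (simp add: algebra_simps)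
      \<comment> \<open>By \<open>le\<close> the difference is nonpositive, so \<open>ge\<close>
        controls its absolute value.\<close>
      then show ?thesis
        using le[OF that] ge[OF that] by (simp add: c_def t_def)
    qed
    then show "\<forall>\<^sub>F n in sequentially. norm (real (adj_count n) - C ^ (2 ^ n))
        \<le> (4 * exp 4) * norm (C ^ (2 ^ (n - 1)))"
      using C by (auto simp: eventually_sequentially)
  qed
  moreover have "C = exp (\<Sum>j. adj_term j)"
    using l by (simp add: C_def sums_unique)
  ultimately show ?thesis using l by (auto simp: sums_iff)
qed

end
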